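(* Let $\gamma>0$, let $\mathcal{W}_\gamma=\{\boldsymbol{w}\in\mathbb{R}^{N_w}\mid \|\boldsymbol{w}\|_2\le\gamma\}$, let $\mathcal{U}\subseteq\mathbb{R}^{N_u}$ be a closed convex set, and let $x_0\in\mathbb{R}^{n_x}$. With $J,\boldsymbol{b},\boldsymbol{B},\boldsymbol{D}$ and $\mathcal{Q}$ as in the context, consider the robust regret-optimal control problem $$\min_{\boldsymbol{u}\in\mathcal{U}}\ \max_{\boldsymbol{w}\in\mathcal{W}_\gamma}\Big(J(x_0,\boldsymbol{u},\boldsymbol{w})-\min_{\boldsymbol{v}\in\mathbb{R}^{N_u}}J(x_0,\boldsymbol{v},\boldsymbol{w})\Big).\qquad(\mathrm{P})$$ Let $S\in\mathbb{R}^{N_w\times N_w}$ be a nonsingular matrix with $S^TS=\operatorname{diag}(\sigma_1,\dots,\sigma_{N_w})$ and $S^T\boldsymbol{D}^T\boldsymbol{B}^{-1}\boldsymbol{D}S=\operatorname{diag}(\tau_1,\dots,\tau_{N_w})$. Then $(\mathrm{P})$ is equivalent to $$\begin{array}{ll}\underset{(\boldsymbol{u},\lambda,t)\in\mathbb{R}^{N_u}\times\mathbb{R}\times\mathbb{R}^{N_w}}{\text{minimize}} & \boldsymbol{u}^T\boldsymbol{B}\boldsymbol{u}+2\boldsymbol{b}^T\boldsymbol{u}+\boldsymbol{1}^Tt+\gamma^2\lambda\\ \text{subject to} & \boldsymbol{u}\in\mathcal{U},\quad \lambda\ge 0,\\ & \big([S^T\boldsymbol{D}^T(\boldsymbol{B}^{-1}\boldsymbol{b}+\boldsymbol{u})]_i,\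 t_i,\ \lambda\sigma_i-\tau_i\big)\in\mathcal{Q},\quad i=1,\dots,N_w,\end{array}\qquad(\mathrm{R})$$ in the following sense: the optimal value of $(\mathrm{P})$ equals the optimal value of $(\mathrm{R})$ plus the constant $\boldsymbol{b}^T\boldsymbol{B}^{-1}\boldsymbol{b}$, and $\boldsymbol{u}^\star$ is optimal for $(\mathrm{P})$ if and only if there is $(\lambda,t)$ such that $(\boldsymbol{u}^\star,\lambda,t)$ is optimal for $(\mathrm{R})$.
   Context: System: $x_{k+1}=A_kx_k+B_ku_k+C_kw_k$, $k=0,\dots,N-1$, with $x_k\in\mathbb{R}^{n_x}$, $u_k\in\mathbb{R}^{n_u}$, $w_k\in\mathbb{R}^{n_w}$, real matrices $A_k,B_k,C_k$ of matching sizes, and horizon $N\ge1$. Put $\boldsymbol{u}=(u_0,\dots,u_{N-1})\in\mathbb{R}^{N_u}$, $\boldsymbol{w}=(w_0,\dots,w_{N-1})\in\mathbb{R}^{N_w}$, $N_u=Nn_u$, $N_w=Nn_w$. Cost: $$J(x_0,\boldsymbol{u},\boldsymbol{w})=\sum_{k=1}^N(x_k^TQ_kx_k+2q_k^Tx_k)+\sum_{k=0}^{N-1}(u_k^TR_ku_k+2r_k^Tu_k),$$ with $Q_k$ symmetric positive semidefinite and $R_k$ symmetric positive definite, $q_k\in\mathbb{R}^{n_x}$, $r_k\in\mathbb{R}^{n_u}$. Compact form: the stacked state $(x_1,\dots,x_N)$ is linear in the data, $(x_1,\dots,x_N)=\mathscr{A}x_0+\mathscr{B}\boldsymbol{u}+\mathscr{C}\boldsymbol{w}$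 for matrices $\mathscr{A},\mathscr{B},\mathscr{C}$ determined by the dynamics. With $\bar Q=\operatorname{blkdiag}(Q_1,\dots,Q_N)$, $\bar R=\operatorname{blkdiag}(R_0,\dots,R_{N-1})$, $\bar q=(q_1,\dots,q_N)$, $\bar r=(r_0,\dots,r_{N-1})$, set $\boldsymbol{A}=\mathscr{A}^T\bar Q\mathscr{A}$, $\boldsymbol{a}=\mathscr{A}^T\bar q$, $\boldsymbol{B}=\mathscr{B}^T\bar Q\mathscr{B}+\bar R\succ0$, $\boldsymbol{b}=\bar r+\mathscr{B}^T(\bar q+\bar Q\mathscr{A}x_0)$, $\boldsymbol{C}=\mathscr{C}^T\bar Q\mathscr{C}$, $\boldsymbol{c}=\mathscr{C}^T(\bar q+\bar Q\mathscr{A}x_0)$, $\boldsymbol{D}=\mathscr{B}^T\bar Q\mathscr{C}$. Then $$J(x_0,\boldsymbol{u},\boldsymbol{w})=\boldsymbol{w}^T\boldsymbol{C}\boldsymbol{w}+2(\boldsymbol{c}+\boldsymbol{D}^T\boldsymbol{u})^T\boldsymbol{w}+\boldsymbol{u}^T\boldsymbol{B}\boldsymbol{u}+2\boldsymbol{b}^T\boldsymbol{u}+2\boldsymbol{a}^Tx_0+x_0^T\boldsymbol{A}x_0.$$ $\mathcal{Q}=\{(x,y,z)\in\mathbb{R}^3\mid \|(2x,\,y-z)\|_2\le y+z\}$. $\boldsymbol{1}$ is the all-ones vector and $[v]_i$ the $i$-th component of $v$. *)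

theory Defs
  imports "HOL-Analysis.Analysis"
begin

text \<open>
  The horizon is \<open>N = CARD('t)\<close> for an arbitrary finite linearly ordered type \<open>'t\<close> of time
  points, which are numbered \<open>0, \<dots>, N - 1\<close> in increasing order. A stacked vector of \<open>N\<close> blocks
  of size \<open>n = CARD('n)\<close>, that is, an element of the Euclidean space of dimension \<open>N * n\<close>, has
  type \<open>real ^ ('t \<times> 'n)\<close>: the entry \<open>(i, a)\<close> is component \<open>a\<close> of block \<open>i\<close>.
\<close>

definition tpos :: "'t::{finite,linorder} \<Rightarrow> nat" where
  "tpos i = card {j. j < i}"

definition tpoint :: "nat \<Rightarrow> 't::{finite,linorder}" where
  "tpoint = inv tpos"

definition block :: "real ^ ('t::{finite,linorder} \<times> 'n::finite) \<Rightarrow> nat \<Rightarrow> real ^ 'n" where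
  "block v k = (\<chi> a. v $ (tpoint k, a))"

definition stack :: "('t::{finite,linorder} \<Rightarrow> real ^ 'n) \<Rightarrow> real ^ ('t \<times> 'n::finite)" where
  "stack v = (\<chi> p. v (fst p) $ snd p)"

definition blkdiag ::
  "('t::{finite,linorder} \<Rightarrow> real ^ 'n ^ 'n) \<Rightarrow> real ^ ('t \<times> 'n::finite) ^ ('t \<times> 'n)" where
  "blkdiag M = (\<chi> p p'. if fst p = fst p' then M (fst p) $ snd p $ snd p' else 0)"

definition diag :: "real ^ 'n \<Rightarrow> real ^ 'n ^ 'n::finite" where
  "diag d = (\<chi> i j. if i = j then d $ i else 0)"

definition sym_psd :: "real ^ 'n ^ 'n::finite \<Rightarrow> bool" where
  "sym_psd M \<longleftrightarrow> transpose M = M \<and> (\<forall>x. 0 \<le> x \<bullet> (M *v x))"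

definition sym_pd :: "real ^ 'n ^ 'n::finite \<Rightarrow> bool" where
  "sym_pd M \<longleftrightarrow> transpose M = M \<and> (\<forall>x. x \<noteq> 0 \<longrightarrow> 0 < x \<bullet> (M *v x))"


subsection \<open>Dynamics and cost\<close>

text \<open>Only the values \<open>A k\<close>, \<open>B k\<close>, \<open>C k\<close>, \<open>R k\<close>, \<open>r k\<close> with \<open>k < N\<close> and \<open>Q k\<close>, \<open>q k\<close> with
  \<open>1 \<le> k \<le> N\<close> are relevant.\<close>

primrec state ::
  "(nat \<Rightarrow> real ^ 'nx ^ 'nx) \<Rightarrow> (nat \<Rightarrow> real ^ 'nu ^ 'nx) \<Rightarrow> (nat \<Rightarrow> real ^ 'nw ^ 'nx) \<Rightarrow>
   real ^ 'nx::finite \<Rightarrow> real ^ ('t::{finite,linorder} \<times> 'nu::finite) \<Rightarrow>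
   real ^ ('t \<times> 'nw::finite) \<Rightarrow> nat \<Rightarrow> real ^ 'nx"
where
  "state A B C x0 u w 0 = x0"
| "state A B C x0 u w (Suc k) =
     A k *v state A B C x0 u w k + B k *v block u k + C k *v block w k"

definition cost ::
  "(nat \<Rightarrow> real ^ 'nx ^ 'nx) \<Rightarrow> (nat \<Rightarrow> real ^ 'nu ^ 'nx) \<Rightarrow> (nat \<Rightarrow> real ^ 'nw ^ 'nx) \<Rightarrow>
   (nat \<Rightarrow> real ^ 'nx ^ 'nx) \<Rightarrow> (nat \<Rightarrow> real ^ 'nx) \<Rightarrow>
   (nat \<Rightarrow> real ^ 'nu ^ 'nu) \<Rightarrow> (nat \<Rightarrow> real ^ 'nu) \<Rightarrow>
   real ^ 'nx::finite \<Rightarrow> real ^ ('t::{finite,linorder} \<times> 'nu::finite) \<Rightarrow>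
   real ^ ('t \<times> 'nw::finite) \<Rightarrow> real"
where
  "cost A B C Q q R r x0 u w =
     (\<Sum>k = 1..CARD('t). state A B C x0 u w k \<bullet> (Q k *v state A B C x0 u w k)
                          + 2 * (q k \<bullet> state A B C x0 u w k))
   + (\<Sum>k = 0..<CARD('t). block u k \<bullet> (R k *v block u k) + 2 * (r k \<bullet> block u k))"


subsection \<open>Compact form\<close>

text \<open>\<open>transition A j k\<close> is the product of \<open>A (k - 1)\<close>, \<dots>, \<open>A j\<close> in this order.\<close>

primrec transition :: "(nat \<Rightarrow> real ^ 'n ^ 'n) \<Rightarrow> nat \<Rightarrow> nat \<Rightarrow> real ^ 'n ^ 'n::finite" where
  "transition A j 0 = mat 1"
| "transition A j (Suc k) = (if j \<le> k then A k ** transition A j k else mat 1)"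

definition state_mat ::
  "(nat \<Rightarrow> real ^ 'nx ^ 'nx) \<Rightarrow> real ^ 'nx ^ ('t::{finite,linorder} \<times> 'nx::finite)" where
  "state_mat A = (\<chi> p. transition A 0 (Suc (tpos (fst p))) $ snd p)"

text \<open>The next matrix is used with \<open>G = B\<close> for the stacked input and with \<open>G = C\<close> for the stacked
  disturbance.\<close>

definition input_mat ::
  "(nat \<Rightarrow> real ^ 'nx ^ 'nx) \<Rightarrow> (nat \<Rightarrow> real ^ 'm ^ 'nx) \<Rightarrow>
   real ^ ('t \<times> 'm::finite) ^ ('t::{finite,linorder} \<times> 'nx::finite)"
where
  "input_mat A G = (\<chi> p p'.
     if tpos (fst p') \<le> tpos (fst p)
     then (transition A (Suc (tpos (fst p'))) (Suc (tpos (fst p))) ** G (tpos (fst p')))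
            $ snd p $ snd p'
     else 0)"

definition Qbar ::
  "(nat \<Rightarrow> real ^ 'nx ^ 'nx) \<Rightarrow> real ^ ('t \<times> 'nx) ^ ('t::{finite,linorder} \<times> 'nx::finite)" where
  "Qbar Q = blkdiag (\<lambda>i. Q (Suc (tpos i)))"

definition Rbar ::
  "(nat \<Rightarrow> real ^ 'nu ^ 'nu) \<Rightarrow> real ^ ('t \<times> 'nu) ^ ('t::{finite,linorder} \<times> 'nu::finite)" where
  "Rbar R = blkdiag (\<lambda>i. R (tpos i))"

definition qbar :: "(nat \<Rightarrow> real ^ 'nx) \<Rightarrow> real ^ ('t::{finite,linorder} \<times> 'nx::finite)" where
  "qbar q = stack (\<lambda>i. q (Suc (tpos i)))"

definition rbar :: "(nat \<Rightarrow> real ^ 'nu) \<Rightarrow> real ^ ('t::{finite,linorder} \<times> 'nu::finite)" where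
  "rbar r = stack (\<lambda>i. r (tpos i))"

definition compact_B ::
  "(nat \<Rightarrow> real ^ 'nx ^ 'nx) \<Rightarrow> (nat \<Rightarrow> real ^ 'nu ^ 'nx) \<Rightarrow>
   (nat \<Rightarrow> real ^ 'nx ^ 'nx::finite) \<Rightarrow> (nat \<Rightarrow> real ^ 'nu ^ 'nu) \<Rightarrow>
   real ^ ('t \<times> 'nu) ^ ('t::{finite,linorder} \<times> 'nu::finite)"
where
  "compact_B A B Q R =
     (let Bc = input_mat A B :: real ^ ('t \<times> 'nu) ^ ('t \<times> 'nx)
      in transpose Bc ** Qbar Q ** Bc + Rbar R)"

definition compact_b ::
  "(nat \<Rightarrow> real ^ 'nx ^ 'nx) \<Rightarrow> (nat \<Rightarrow> real ^ 'nu ^ 'nx) \<Rightarrow>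
   (nat \<Rightarrow> real ^ 'nx ^ 'nx::finite) \<Rightarrow> (nat \<Rightarrow> real ^ 'nx) \<Rightarrow> (nat \<Rightarrow> real ^ 'nu) \<Rightarrow>
   real ^ 'nx \<Rightarrow> real ^ ('t::{finite,linorder} \<times> 'nu::finite)"
where
  "compact_b A B Q q r x0 =
     (let Ac = state_mat A :: real ^ 'nx ^ ('t \<times> 'nx);
          Bc = input_mat A B :: real ^ ('t \<times> 'nu) ^ ('t \<times> 'nx)
      in rbar r + transpose Bc *v (qbar q + Qbar Q *v (Ac *v x0)))"

definition compact_D ::
  "(nat \<Rightarrow> real ^ 'nx ^ 'nx) \<Rightarrow> (nat \<Rightarrow> real ^ 'nu ^ 'nx) \<Rightarrow> (nat \<Rightarrow> real ^ 'nw ^ 'nx) \<Rightarrow>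
   (nat \<Rightarrow> real ^ 'nx ^ 'nx::finite) \<Rightarrow>
   real ^ ('t \<times> 'nw::finite) ^ ('t::{finite,linorder} \<times> 'nu::finite)"
where
  "compact_D A B C Q =
     (let Bc = input_mat A B :: real ^ ('t \<times> 'nu) ^ ('t \<times> 'nx);
          Cc = input_mat A C :: real ^ ('t \<times> 'nw) ^ ('t \<times> 'nx)
      in transpose Bc ** Qbar Q ** Cc)"


subsection \<open>The two optimization problems\<close>

text \<open>Optimal values are infima and suprema in the extended reals, so that no existence of
  optimizers is presupposed and the infimum over an empty feasible set is \<open>\<infinity>\<close>.\<close>

definition regret :: "('u \<Rightarrow> 'w \<Rightarrow> real) \<Rightarrow> 'u \<Rightarrow> 'w \<Rightarrow> ereal" where
  "regret J u w = ereal (J u w) - (INF v. ereal (J v w))"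

definition worst_regret :: "('u \<Rightarrow> 'w::real_normed_vector \<Rightarrow> real) \<Rightarrow> real \<Rightarrow> 'u \<Rightarrow> ereal" where
  "worst_regret J \<gamma> u = (SUP w\<in>{w. norm w \<le> \<gamma>}. regret J u w)"

text \<open>On \<open>real \<times> real\<close> the library norm is the Euclidean norm.\<close>

definition cone_Q :: "(real \<times> real \<times> real) set" where
  "cone_Q = {(x, y, z). norm (2 * x, y - z) \<le> y + z}"

definition reform_feasible ::
  "(real ^ 'p) set \<Rightarrow> real ^ 'm ^ 'm \<Rightarrow> real ^ 'p ^ 'p \<Rightarrow> real ^ 'p \<Rightarrow> real ^ 'm ^ 'p \<Rightarrow>
   real ^ 'm \<Rightarrow> real ^ 'm \<Rightarrow> ((real ^ 'p::finite) \<times> real \<times> (real ^ 'm::finite)) set"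
where
  "reform_feasible U S BB b D \<sigma> \<tau> =
     {(u, l, t). u \<in> U \<and> 0 \<le> l \<and>
        (\<forall>i. ((transpose S *v (transpose D *v (matrix_inv BB *v b + u))) $ i,
              t $ i, l * \<sigma> $ i - \<tau> $ i) \<in> cone_Q)}"

text \<open>As a vector, \<open>1\<close> has all entries equal to one.\<close>

definition reform_objective ::
  "real ^ 'p ^ 'p \<Rightarrow> real ^ 'p \<Rightarrow> real \<Rightarrow>
   (real ^ 'p::finite) \<times> real \<times> (real ^ 'm::finite) \<Rightarrow> real"
where
  "reform_objective BB b \<gamma> =
     (\<lambda>(u, l, t). u \<bullet> (BB *v u) + 2 * (b \<bullet> u) + 1 \<bullet> t + \<gamma>\<^sup>2 * l)"


subsection \<open>Correctness of the compact form\<close>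

lemma tpos_bij: "bij_betw (tpos :: 't::{finite,linorder} \<Rightarrow> nat) UNIV {..<CARD('t)}"
proof -
  have sm: "tpos i < tpos j" if "i < j" for i j :: 't
    unfolding tpos_def using that by (intro psubset_card_mono) auto
  have inj: "inj (tpos :: 't \<Rightarrow> nat)"
    using sm by (intro linorder_injI) (metis less_irrefl)
  have "tpos i < CARD('t)" for i :: 't
    unfolding tpos_def by (intro psubset_card_mono) auto
  then have "tpos ` (UNIV :: 't set) = {..<CARD('t)}"
    using inj by (intro card_subset_eq) (auto simp: card_image)
  then show ?thesis using inj by (simp add: bij_betw_def)
qed

lemma tpoint_tpos [simp]: "tpoint (tpos i) = i"
  unfolding tpoint_def using tpos_bij by (intro inv_f_f) (auto simp: bij_betw_def)

lemma tpos_less: "tpos (i :: 't::{finite,linorder}) < CARD('t)"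
  using tpos_bij[where 't = 't] by (auto simp: bij_betw_def)

lemma sum_tpos: "(\<Sum>i\<in>UNIV. f (tpos (i :: 't::{finite,linorder}))) = (\<Sum>k<CARD('t). f k)"
  by (rule sum.reindex_bij_betw[OF tpos_bij])

lemma state_eq:
  "state A B C x0 u w k = transition A 0 k *v x0 +
     (\<Sum>j<k. transition A (Suc j) k *v (B j *v block u j + C j *v block w j))"
proof (induction k)
  case (Suc k)
  have "A k *v (\<Sum>j<k. transition A (Suc j) k *v (B j *v block u j + C j *v block w j)) =
     (\<Sum>j<k. A k *v (transition A (Suc j) k *v (B j *v block u j + C j *v block w j)))"
    by (rule linear_sum[OF matrix_vector_mul_linear])
  also have "\<dots> =
     (\<Sum>j<k. transition A (Suc j) (Suc k) *v (B j *v block u j + C j *v block w j))"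
    by (intro sum.cong) (auto simp: matrix_vector_mul_assoc)
  finally show ?case using Suc
    by (simp add: matrix_vector_right_distrib matrix_vector_mul_assoc[symmetric] algebra_simps)
qed simp

lemma input_mat_mult:
  fixes v :: "real ^ ('t::{finite,linorder} \<times> 'm::finite)" and i :: 't
  shows "(input_mat A G *v v) $ (i, a) =
    (\<Sum>j<Suc (tpos i). transition A (Suc j) (Suc (tpos i)) *v (G j *v block v j)) $ a"
proof -
  let ?f = "\<lambda>k. if k \<le> tpos i
    then (transition A (Suc k) (Suc (tpos i)) *v (G k *v block v k)) $ a else 0"
  have "(input_mat A G *v v) $ (i, a) = (\<Sum>j\<in>UNIV. \<Sum>b\<in>UNIV. input_mat A G $ (i, a) $ (j, b) * v $ (j, b))"
    by (simp add: matrix_vector_mult_def sum.cartesian_product)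
  also have "\<dots> = (\<Sum>j\<in>UNIV. ?f (tpos (j :: 't)))"
  proof (intro sum.cong refl)
    fix j :: 't
    let ?M = "transition A (Suc (tpos j)) (Suc (tpos i)) ** G (tpos j)"
    have "(?M *v block v (tpos j)) $ a = (\<Sum>b\<in>UNIV. ?M $ a $ b * v $ (j, b))"
      by (simp add: matrix_vector_mult_def block_def)
    then show "(\<Sum>b\<in>UNIV. input_mat A G $ (i, a) $ (j, b) * v $ (j, b)) = ?f (tpos j)"
      by (simp add: input_mat_def matrix_vector_mul_assoc del: transition.simps)
  qed
  also have "\<dots> = (\<Sum>k<CARD('t). ?f k)"
    by (rule sum_tpos)
  also have "\<dots> = (\<Sum>k<Suc (tpos i). ?f k)"
    using tpos_less[of i] by (intro sum.mono_neutral_right) auto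
  also have "\<dots> = (\<Sum>j<Suc (tpos i). (transition A (Suc j) (Suc (tpos i)) *v (G j *v block v j)) $ a)"
    by (intro sum.cong) auto
  finally show ?thesis by (simp only: sum_component)
qed

lemma stack_state:
  "stack (\<lambda>i. state A B C x0 u w (Suc (tpos i)))
     = state_mat A *v x0 + input_mat A B *v u + input_mat A C *v w"
proof -
  have "stack (\<lambda>i. state A B C x0 u w (Suc (tpos i))) $ (i, a) =
      (state_mat A *v x0 + input_mat A B *v u + input_mat A C *v w) $ (i, a)" for i a
  proof -
    have "(state_mat A *v x0) $ (i, a) = (transition A 0 (Suc (tpos i)) *v x0) $ a"
      by (simp only: matrix_vector_mult_def state_mat_def vec_lambda_beta fst_conv snd_conv)
    then show ?thesis
      unfolding vector_add_component input_mat_mult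
      by (simp only: stack_def state_eq vec_lambda_beta fst_conv snd_conv vector_add_component
          matrix_vector_right_distrib sum.distrib)
  qed
  then show ?thesis by (metis vec_eq_iff surj_pair)
qed

lemma inner_pair: "x \<bullet> y = (\<Sum>i\<in>UNIV. \<Sum>a\<in>UNIV. x $ (i, a) * y $ (i, a))"
  for x y :: "real ^ ('t::finite \<times> 'n::finite)"
  by (simp add: inner_vec_def sum.cartesian_product)

lemma stack_inner: "stack f \<bullet> stack g = (\<Sum>i\<in>UNIV. f i \<bullet> g i)"
  by (simp add: inner_pair stack_def) (simp add: inner_vec_def)

lemma blkdiag_stack: "blkdiag M *v stack f = stack (\<lambda>i. M i *v f i)"
proof -
  have "(blkdiag M *v stack f) $ (i, a) = stack (\<lambda>i. M i *v f i) $ (i, a)" for i a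
  proof -
    have "(blkdiag M *v stack f) $ (i, a) =
       (\<Sum>j\<in>UNIV. \<Sum>b\<in>UNIV. (if i = j then M i $ a $ b * f j $ b else 0))"
      unfolding matrix_vector_mult_def
      by (simp add: sum.cartesian_product blkdiag_def stack_def if_distrib cong: if_cong)
         (intro sum.cong, auto)
    also have "\<dots> = (\<Sum>j\<in>UNIV. if i = j then (\<Sum>b\<in>UNIV. M i $ a $ b * f j $ b) else 0)"
      by (intro sum.cong) auto
    finally show ?thesis by (simp add: stack_def matrix_vector_mult_def)
  qed
  then show ?thesis by (metis vec_eq_iff surj_pair)
qed

lemma stack_block: "stack (\<lambda>i. block u (tpos i)) = u"
  by (simp add: stack_def block_def vec_eq_iff)

lemma cost_stacked:
  fixes u :: "real ^ ('t::{finite,linorder} \<times> 'nu::finite)"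
    and w :: "real ^ ('t \<times> 'nw::finite)" and x0 :: "real ^ 'nx::finite" and A B C
  defines "x \<equiv> state_mat A *v x0 + input_mat A B *v u + input_mat A C *v w"
  shows "cost A B C Q q R r x0 u w =
     x \<bullet> (Qbar Q *v x) + 2 * (qbar q \<bullet> x) + u \<bullet> (Rbar R *v u) + 2 * (rbar r \<bullet> u)"
proof -
  have x: "x = stack (\<lambda>i. state A B C x0 u w (Suc (tpos i)))"
    unfolding x_def by (rule stack_state[symmetric])
  let ?s = "state A B C x0 u w"
  have "(\<Sum>k = 1..CARD('t). ?s k \<bullet> (Q k *v ?s k) + 2 * (q k \<bullet> ?s k)) =
     (\<Sum>k<CARD('t). ?s (Suc k) \<bullet> (Q (Suc k) *v ?s (Suc k)) + 2 * (q (Suc k) \<bullet> ?s (Suc k)))"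
    by (rule sum.reindex_bij_witness[of _ Suc "\<lambda>k. k - 1"]) auto
  also have "\<dots> = x \<bullet> (Qbar Q *v x) + 2 * (qbar q \<bullet> x)"
    unfolding sum_tpos[where 't = 't, symmetric] x Qbar_def qbar_def blkdiag_stack stack_inner
    by (simp add: sum.distrib sum_distrib_left)
  finally have 1: "(\<Sum>k = 1..CARD('t). ?s k \<bullet> (Q k *v ?s k) + 2 * (q k \<bullet> ?s k)) =
    x \<bullet> (Qbar Q *v x) + 2 * (qbar q \<bullet> x)" .
  have "(\<Sum>k = 0..<CARD('t). block u k \<bullet> (R k *v block u k) + 2 * (r k \<bullet> block u k)) =
    u \<bullet> (Rbar R *v u) + 2 * (rbar r \<bullet> u)"
  proof -
    let ?v = "stack (\<lambda>i :: 't. block u (tpos i))"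
    have "(\<Sum>k = 0..<CARD('t). block u k \<bullet> (R k *v block u k) + 2 * (r k \<bullet> block u k)) =
      ?v \<bullet> (Rbar R *v ?v) + 2 * (rbar r \<bullet> ?v)"
      unfolding atLeast0LessThan sum_tpos[where 't = 't, symmetric] Rbar_def rbar_def
        blkdiag_stack stack_inner
      by (simp add: sum.distrib sum_distrib_left)
    then show ?thesis by (simp only: stack_block)
  qed
  with 1 show ?thesis unfolding cost_def by simp
qed

lemma transpose_Qbar:
  assumes "\<And>k. 1 \<le> k \<Longrightarrow> k \<le> CARD('t) \<Longrightarrow> transpose (Q k) = Q k"
  shows "transpose (Qbar Q) = (Qbar Q :: real ^ ('t::{finite,linorder} \<times> 'n::finite) ^ ('t \<times> 'n))"
proof -
  have "Q (Suc (tpos i)) $ a $ c = Q (Suc (tpos i)) $ c $ a" for i :: 't and a c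
    using assms[of "Suc (tpos i)"] tpos_less[of i] by (auto simp: transpose_def vec_eq_iff)
  then show ?thesis
    by (simp add: Qbar_def blkdiag_def transpose_def vec_eq_iff)
qed

lemma cost_compact:
  fixes u :: "real ^ ('t::{finite,linorder} \<times> 'nu::finite)"
    and w :: "real ^ ('t \<times> 'nw::finite)" and x0 :: "real ^ 'nx::finite" and A B C Q q
  defines "Ac \<equiv> state_mat A :: real ^ 'nx ^ ('t \<times> 'nx)"
    and "Cc \<equiv> input_mat A C :: real ^ ('t \<times> 'nw) ^ ('t \<times> 'nx)"
    and "Qb \<equiv> Qbar Q :: real ^ ('t \<times> 'nx) ^ ('t \<times> 'nx)"
    and "qb \<equiv> qbar q :: real ^ ('t \<times> 'nx)"
  assumes Q: "\<And>k. 1 \<le> k \<Longrightarrow> k \<le> CARD('t) \<Longrightarrow> sym_psd (Q k)"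
  shows "cost A B C Q q R r x0 u w =
      w \<bullet> ((transpose Cc ** Qb ** Cc) *v w)
    + 2 * ((transpose Cc *v (qb + Qb *v (Ac *v x0)) + transpose (compact_D A B C Q) *v u) \<bullet> w)
    + u \<bullet> (compact_B A B Q R *v u) + 2 * (compact_b A B Q q r x0 \<bullet> u)
    + 2 * ((transpose Ac *v qb) \<bullet> x0) + x0 \<bullet> ((transpose Ac ** Qb ** Ac) *v x0)"
proof -
  define Bc :: "real ^ ('t \<times> 'nu) ^ ('t \<times> 'nx)" where "Bc = input_mat A B"
  have tr: "x \<bullet> (transpose M *v y) = (M *v x) \<bullet> y" for M :: "real ^ 'a::finite ^ 'b::finite" and x y
    by (metis dot_lmul_matrix inner_commute transpose_matrix_vector vector_transpose_matrix)
  have tr': "(transpose M *v y) \<bullet> x = y \<bullet> (M *v x)" for M :: "real ^ 'a::finite ^ 'b::finite" and x y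
    using tr[of x M y] by (simp add: inner_commute)
  have sym: "transpose Qb = Qb"
    unfolding Qb_def using Q by (intro transpose_Qbar) (auto simp: sym_psd_def)
  have comm: "x \<bullet> (Qb *v y) = y \<bullet> (Qb *v x)" for x y
    using tr[of x Qb y] sym by (simp add: inner_commute)
  show ?thesis
    unfolding cost_stacked compact_B_def compact_b_def compact_D_def Let_def
      Ac_def[symmetric] Bc_def[symmetric] Cc_def[symmetric] Qb_def[symmetric] qb_def[symmetric]
    using comm[of "Bc *v u" "Ac *v x0"] comm[of "Cc *v w" "Ac *v x0"] comm[of "Cc *v w" "Bc *v u"]
    by (simp add: matrix_transpose_mul sym matrix_vector_mul_assoc[symmetric] matrix_vector_mult_add_rdistrib
        matrix_vector_right_distrib inner_add_left inner_add_right tr tr' inner_commute[of "_ *v _" qb]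
        del: transpose_matrix_vector)
       (simp add: inner_commute algebra_simps del: transpose_matrix_vector)?
qed

end

theory Submission
  imports Defs
begin

text \<open>
  For a fixed disturbance \<open>w\<close> the cost is a strictly convex quadratic function of the input. Its
  minimum lies at \<open>v = - BB\<inverse> (b + D w)\<close>, so completing the square shows that the regret
  is the squared distance of \<open>u\<close> to that point in the norm of \<open>BB\<close>. All terms that depend on \<open>w\<close>
  alone cancel, except \<open>w\<^sup>T D\<^sup>T BB\<inverse> D w\<close>; what remains is a quadratic
  function of \<open>w\<close> whose linear part is affine in \<open>u\<close> (\<open>regret_quadratic\<close>).

  The substitution \<open>w = S y\<close> diagonalises this quadratic function together with the constraint
  \<open>norm w \<le> \<gamma>\<close>. The worst-case regret is therefore, up to terms in \<open>u\<close> alone, the maximum of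
  \<open>\<Sum>i. \<tau> i * (y i)\<^sup>2 + 2 * g i * y i\<close> subject to \<open>\<Sum>i. \<sigma> i * (y i)\<^sup>2 \<le> \<gamma>\<^sup>2\<close>, where \<open>g\<close> is
  the vector that enters the cone constraints. This is a convex function maximised over an
  ellipsoid, yet it has no duality gap. For a multiplier \<open>l\<close>, coordinate \<open>i\<close> contributes
  \<open>(g i)\<^sup>2 / (l * \<sigma> i - \<tau> i)\<close> to the dual function, and the cone constraint expresses that \<open>t i\<close>
  bounds this number; so minimising over \<open>(l, t)\<close> evaluates the dual problem. Weak duality is the
  inequality \<open>cone_Q_young\<close> in each coordinate. Strong duality rests on
  \<open>trust_region_multiplier\<close>: some \<open>y\<close> on the boundary of the ellipsoid is stationary for a
  multiplier that makes all \<open>l * \<sigma> i - \<tau> i\<close> nonnegative.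

  Hence, for every \<open>u\<close>, the worst-case regret is an attained minimum over \<open>(l, t)\<close> of the
  objective of the conic problem plus the constant (\<open>worst_regret_dual\<close>). Equality of the optimal
  values and the correspondence of minimisers follow by minimising in two stages
  (\<open>partial_minimisation\<close>).
\<close>

section \<open>Positive definite matrices\<close>

lemma inner_transpose_mult:
  fixes M :: "real ^ 'a::finite ^ 'b::finite"
  shows "(transpose M *v y) \<bullet> x = y \<bullet> (M *v x)"
  by (simp add: dot_lmul_matrix)

lemma inner_mult_comm:
  assumes "sym_pd M"
  shows "x \<bullet> (M *v y) = y \<bullet> (M *v x)"
  using inner_transpose_mult[of M x y] assms by (simp add: sym_pd_def inner_commute del: transpose_matrix_vector)

lemma sym_pd_nonneg:
  assumes "sym_pd M"
  shows "0 \<le> x \<bullet> (M *v x)"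
  using assms by (cases "x = 0") (auto simp: sym_pd_def less_imp_le)

lemma sym_pd_invertible:
  assumes "sym_pd M"
  shows "invertible M"
proof -
  have "M *v x = 0 \<Longrightarrow> x = 0" for x
    using assms by (force simp: sym_pd_def)
  then show ?thesis
    by (simp add: invertible_left_inverse matrix_left_invertible_ker)
qed

lemma matrix_inv_inverse:
  fixes M :: "real ^ 'n ^ 'n::finite"
  assumes "invertible M"
  shows matrix_inv_right: "M ** matrix_inv M = mat 1" and matrix_inv_left: "matrix_inv M ** M = mat 1"
  using someI_ex[OF assms[unfolded invertible_def]] by (auto simp: matrix_inv_def)

lemma matrix_inv_cancel:
  fixes M :: "real ^ 'n ^ 'n::finite"
  assumes "invertible M"
  shows "M *v (matrix_inv M *v x) = x"
  by (simp add: matrix_vector_mul_assoc matrix_inv_right[OF assms])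

lemma matrix_inv_psd:
  assumes "sym_pd M"
  shows "0 \<le> x \<bullet> (matrix_inv M *v x)"
  using sym_pd_nonneg[OF assms, of "matrix_inv M *v x"]
  by (simp add: matrix_inv_cancel sym_pd_invertible assms inner_commute)

lemma matrix_inv_sym:
  assumes "sym_pd M"
  shows "x \<bullet> (matrix_inv M *v y) = y \<bullet> (matrix_inv M *v x)"
  using inner_mult_comm[OF assms, of "matrix_inv M *v x" "matrix_inv M *v y"]
  by (simp add: matrix_inv_cancel sym_pd_invertible assms inner_commute)

lemma complete_square:
  assumes "sym_pd M"
  shows "v \<bullet> (M *v v) + 2 * (h \<bullet> v) =
    (v + matrix_inv M *v h) \<bullet> (M *v (v + matrix_inv M *v h)) - h \<bullet> (matrix_inv M *v h)"
  using inner_mult_comm[OF assms, of "matrix_inv M *v h" v]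
  by (simp add: matrix_vector_right_distrib inner_add_left inner_add_right matrix_inv_cancel
      sym_pd_invertible assms inner_commute)

lemma blkdiag_quadratic:
  fixes x :: "real ^ ('t::{finite,linorder} \<times> 'n::finite)"
  shows "x \<bullet> (blkdiag M *v x) = (\<Sum>i\<in>UNIV. block x (tpos i) \<bullet> (M i *v block x (tpos i)))"
  using stack_inner[of "\<lambda>i. block x (tpos i)" "\<lambda>i. M i *v block x (tpos i)"]
  by (simp add: blkdiag_stack[symmetric] stack_block)

text \<open>The curvature of the cost in the inputs is strictly positive because every input block is
  penalised by its own positive definite \<open>R\<close>; the state penalty can only add to it.\<close>

lemma compact_B_sym_pd:
  fixes Q :: "nat \<Rightarrow> real ^ 'nx ^ 'nx::finite" and R :: "nat \<Rightarrow> real ^ 'nu ^ 'nu::finite"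
  assumes Q: "\<And>k. 1 \<le> k \<Longrightarrow> k \<le> CARD('t) \<Longrightarrow> sym_psd (Q k)"
    and R: "\<And>k. k < CARD('t) \<Longrightarrow> sym_pd (R k)"
  shows "sym_pd (compact_B A B Q R :: real ^ ('t \<times> 'nu) ^ ('t::{finite,linorder} \<times> 'nu))"
proof -
  define G :: "real ^ ('t \<times> 'nu) ^ ('t \<times> 'nx)" where "G = input_mat A B"
  define Qb :: "real ^ ('t \<times> 'nx) ^ ('t \<times> 'nx)" where "Qb = Qbar Q"
  define Rb :: "real ^ ('t \<times> 'nu) ^ ('t \<times> 'nu)" where "Rb = Rbar R"
  have BB: "compact_B A B Q R = transpose G ** Qb ** G + Rb"
    by (simp add: compact_B_def G_def Qb_def Rb_def Let_def)
  have Qs: "transpose Qb = Qb"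
    unfolding Qb_def using Q by (intro transpose_Qbar) (auto simp: sym_psd_def)
  have "R (tpos i) $ a $ c = R (tpos i) $ c $ a" for i :: 't and a c
    using R[OF tpos_less[of i]] by (auto simp: sym_pd_def transpose_def vec_eq_iff)
  then have Rs: "transpose Rb = Rb"
    by (simp add: Rb_def Rbar_def blkdiag_def transpose_def vec_eq_iff)
  have add: "transpose (M + N) = transpose M + transpose N"
    for M N :: "real ^ ('t \<times> 'nu) ^ ('t \<times> 'nu)"
    by (simp add: transpose_def vec_eq_iff)
  have sym: "transpose (transpose G ** Qb ** G + Rb) = transpose G ** Qb ** G + Rb"
    by (simp add: add matrix_transpose_mul Qs Rs matrix_mul_assoc)
  have pos: "0 < x \<bullet> ((transpose G ** Qb ** G + Rb) *v x)" if "x \<noteq> 0" for x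
  proof -
    have "x \<bullet> ((transpose G ** Qb ** G + Rb) *v x) = (G *v x) \<bullet> (Qb *v (G *v x)) + x \<bullet> (Rb *v x)"
      using inner_transpose_mult[of G "Qb *v (G *v x)" x]
      by (simp add: matrix_vector_mult_add_rdistrib inner_add_right matrix_vector_mul_assoc[symmetric]
          inner_commute del: transpose_matrix_vector)
    moreover have "0 \<le> (G *v x) \<bullet> (Qb *v (G *v x))"
      unfolding Qb_def Qbar_def blkdiag_quadratic
      using Q tpos_less[where 't = 't] by (intro sum_nonneg) (simp add: sym_psd_def Suc_le_eq)
    moreover have "0 < x \<bullet> (Rb *v x)"
    proof -
      have "stack (\<lambda>i :: 't. block x (tpos i)) \<noteq> 0"
        using that by (simp add: stack_block)
      then obtain i :: 't where i: "block x (tpos i) \<noteq> 0"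
        by (auto simp: stack_def vec_eq_iff)
      show ?thesis
        unfolding Rb_def Rbar_def blkdiag_quadratic
      proof (rule sum_pos2[where i = i])
        show "0 < block x (tpos i) \<bullet> (R (tpos i) *v block x (tpos i))"
          using R[OF tpos_less[of i]] i by (simp add: sym_pd_def)
      qed (auto intro!: sym_pd_nonneg R tpos_less)
    qed
    ultimately show ?thesis by linarith
  qed
  show ?thesis
    unfolding BB using sym pos by (auto simp: sym_pd_def)
qed

section \<open>Duality for diagonal trust-region problems\<close>

text \<open>
  Away from its poles the stationarity condition determines \<open>y\<close> from \<open>l\<close>, so that the length of
  \<open>y\<close> becomes a function \<open>\<phi>\<close> of \<open>l\<close>. The admissible multipliers are those above the largest
  ratio \<open>m\<close> of \<open>\<tau> i\<close> to \<open>\<sigma> i\<close>, and \<open>\<phi>\<close> tends to \<open>0\<close> at infinity. If \<open>\<phi>\<close> exceeds \<open>\<gamma>\<^sup>2\<close>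
  somewhere above \<open>m\<close>, the intermediate value theorem yields \<open>l\<close>. Otherwise \<open>\<phi>\<close> has no pole at
  \<open>m\<close> and is at most \<open>\<gamma>\<^sup>2\<close> there; then \<open>l = m\<close> works, since stationarity leaves the coordinates where
  \<open>m\<close> is attained free.
\<close>

lemma trust_region_multiplier:
  fixes \<sigma> \<tau> g :: "real ^ 'm::finite"
  assumes \<sigma>: "\<And>i. 0 < \<sigma> $ i" and \<tau>: "\<And>i. 0 \<le> \<tau> $ i" and \<gamma>: "0 < \<gamma>"
  obtains l y where "0 \<le> l" "\<And>i. \<tau> $ i \<le> l * \<sigma> $ i"
    "\<And>i. g $ i = (l * \<sigma> $ i - \<tau> $ i) * y $ i" "(\<Sum>i\<in>UNIV. \<sigma> $ i * (y $ i)\<^sup>2) = \<gamma>\<^sup>2"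
proof -
  define m where "m = Max (range (\<lambda>i. \<tau> $ i / \<sigma> $ i))"
  define \<phi> where "\<phi> l = (\<Sum>i\<in>UNIV. \<sigma> $ i * (g $ i / (l * \<sigma> $ i - \<tau> $ i))\<^sup>2)" for l
  have "m \<in> range (\<lambda>i. \<tau> $ i / \<sigma> $ i)"
    unfolding m_def by (intro Max_in) auto
  then obtain k where k: "m = \<tau> $ k / \<sigma> $ k" by blast
  have m0: "0 \<le> m"
    unfolding k using \<sigma>[of k] \<tau>[of k] by simp
  have "\<tau> $ i / \<sigma> $ i \<le> m" for i
    unfolding m_def by (intro Max_ge) auto
  then have m: "\<tau> $ i \<le> m * \<sigma> $ i" for i
    using \<sigma>[of i] by (simp add: divide_le_eq)
  have mono: "(l - m) * \<sigma> $ i \<le> l * \<sigma> $ i - \<tau> $ i" for l i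
    using m[of i] by (simp add: algebra_simps)
  have kk: "m * \<sigma> $ k - \<tau> $ k = 0"
    using \<sigma>[of k] by (simp add: k)
  show thesis
  proof (cases "(\<forall>i. g $ i \<noteq> 0 \<longrightarrow> 0 < m * \<sigma> $ i - \<tau> $ i) \<and> \<phi> m \<le> \<gamma>\<^sup>2")
    case True
    \<comment> \<open>The missing length goes into coordinate \<open>k\<close>, whose coefficient vanishes. By the convention
      \<open>x / 0 = 0\<close> this coordinate contributes nothing to \<open>\<phi> m\<close>.\<close>
    have gk: "g $ k = 0" using True kk by force
    define s where "s = sqrt ((\<gamma>\<^sup>2 - \<phi> m) / \<sigma> $ k)"
    have s: "\<sigma> $ k * s\<^sup>2 = \<gamma>\<^sup>2 - \<phi> m"
      using True \<sigma>[of k] by (simp add: s_def)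
    define y where "y = (\<chi> i. if i = k then s else g $ i / (m * \<sigma> $ i - \<tau> $ i))"
    have "(\<Sum>i\<in>UNIV. \<sigma> $ i * (y $ i)\<^sup>2)
        = (\<Sum>i\<in>UNIV. (if i = k then \<sigma> $ k * s\<^sup>2 else 0) + \<sigma> $ i * (g $ i / (m * \<sigma> $ i - \<tau> $ i))\<^sup>2)"
      by (intro sum.cong) (auto simp: y_def gk)
    also have "\<dots> = \<gamma>\<^sup>2"
      by (simp add: sum.distrib s \<phi>_def[symmetric])
    finally have len: "(\<Sum>i\<in>UNIV. \<sigma> $ i * (y $ i)\<^sup>2) = \<gamma>\<^sup>2" .
    have "g $ i = (m * \<sigma> $ i - \<tau> $ i) * y $ i" for i
      using True gk kk by (cases "g $ i = 0") (auto simp: y_def)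
    then show ?thesis using that[of m y] m0 m len by blast
  next
    case False
    have "\<exists>l1\<ge>m. \<gamma>\<^sup>2 \<le> \<phi> l1 \<and> (\<forall>i. g $ i \<noteq> 0 \<longrightarrow> 0 < l1 * \<sigma> $ i - \<tau> $ i)"
    proof (cases "\<forall>i. g $ i \<noteq> 0 \<longrightarrow> 0 < m * \<sigma> $ i - \<tau> $ i")
      case True
      then show ?thesis using False by (intro exI[of _ m]) auto
    next
      case False
      then obtain j where j: "g $ j \<noteq> 0" "m * \<sigma> $ j \<le> \<tau> $ j" by (auto simp: not_less)
      then have j': "\<tau> $ j = m * \<sigma> $ j" using m[of j] by simp
      \<comment> \<open>The term of \<open>\<phi>\<close> at \<open>j\<close> has a pole at \<open>m\<close>; the distance \<open>e\<close> from the pole is chosen so that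
        this term alone equals \<open>\<gamma>\<^sup>2\<close>.\<close>
      define e where "e = \<bar>g $ j\<bar> / (\<gamma> * sqrt (\<sigma> $ j))"
      have e: "0 < e" using j(1) \<sigma>[of j] \<gamma> by (simp add: e_def)
      have "\<sigma> $ j * (g $ j / ((m + e) * \<sigma> $ j - \<tau> $ j))\<^sup>2 = (g $ j)\<^sup>2 / (\<sigma> $ j * e\<^sup>2)"
        using \<sigma>[of j] e by (simp add: j' field_simps power2_eq_square)
      also have "\<dots> = \<gamma>\<^sup>2"
        using \<sigma>[of j] j(1) \<gamma> by (simp add: e_def power_divide power_mult_distrib)
      finally have "\<gamma>\<^sup>2 = \<sigma> $ j * (g $ j / ((m + e) * \<sigma> $ j - \<tau> $ j))\<^sup>2" ..
      also have "\<dots> \<le> \<phi> (m + e)"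
        unfolding \<phi>_def by (rule member_le_sum) (auto intro!: mult_nonneg_nonneg less_imp_le[OF \<sigma>])
      finally have "\<gamma>\<^sup>2 \<le> \<phi> (m + e)" .
      moreover have "0 < (m + e) * \<sigma> $ i - \<tau> $ i" for i
        using mono[of "m + e" i] mult_pos_pos[OF e \<sigma>[of i]] by simp
      ultimately show ?thesis using e by (intro exI[of _ "m + e"]) auto
    qed
    then obtain l1 where l1: "m \<le> l1" "\<gamma>\<^sup>2 \<le> \<phi> l1"
      "\<And>i. g $ i \<noteq> 0 \<Longrightarrow> 0 < l1 * \<sigma> $ i - \<tau> $ i" by blast
    have pos: "0 < l * \<sigma> $ i - \<tau> $ i" if "l1 \<le> l" "g $ i \<noteq> 0" for l i
      using l1(3)[OF that(2)] mult_right_mono[OF that(1) less_imp_le[OF \<sigma>[of i]]] by linarith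
    \<comment> \<open>Bounding each denominator from below by \<open>(l - m) * \<sigma> i\<close> gives \<open>\<phi> l \<le> G / (l - m)\<^sup>2\<close>,
      so \<open>\<phi>\<close> is at most \<open>\<gamma>\<^sup>2\<close> once \<open>l - m\<close> is at least \<open>sqrt G / \<gamma>\<close>. The summand \<open>1\<close> in \<open>l2\<close>
      keeps \<open>l2 - m\<close> positive when \<open>G = 0\<close>.\<close>
    define G where "G = (\<Sum>i\<in>UNIV. (g $ i)\<^sup>2 / \<sigma> $ i)"
    have G: "0 \<le> G" unfolding G_def by (intro sum_nonneg) (simp add: less_imp_le[OF \<sigma>])
    define l2 where "l2 = l1 + sqrt G / \<gamma> + 1"
    have gap: "sqrt G / \<gamma> \<le> l2 - m" "0 < l2 - m" and l12: "l1 \<le> l2"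
      using l1(1) divide_nonneg_pos[OF real_sqrt_ge_zero[OF G] \<gamma>] by (auto simp: l2_def)
    have square_mono: "(x / d)\<^sup>2 \<le> (x / a)\<^sup>2" if "0 < a" "a \<le> d" for x a d :: real
      unfolding power_divide using that by (intro divide_left_mono power_mono) auto
    have "\<phi> l2 \<le> (\<Sum>i\<in>UNIV. (g $ i)\<^sup>2 / \<sigma> $ i / (l2 - m)\<^sup>2)"
      unfolding \<phi>_def
    proof (intro sum_mono)
      fix i
      have p: "0 < (l2 - m) * \<sigma> $ i" using gap(2) \<sigma>[of i] by simp
      have "(g $ i / (l2 * \<sigma> $ i - \<tau> $ i))\<^sup>2 \<le> (g $ i / ((l2 - m) * \<sigma> $ i))\<^sup>2"
        using square_mono[OF p mono[of l2 i]] .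
      then have "\<sigma> $ i * (g $ i / (l2 * \<sigma> $ i - \<tau> $ i))\<^sup>2 \<le> \<sigma> $ i * (g $ i / ((l2 - m) * \<sigma> $ i))\<^sup>2"
        using \<sigma>[of i] by simp
      also have "\<dots> = (g $ i)\<^sup>2 / \<sigma> $ i / (l2 - m)\<^sup>2"
        using \<sigma>[of i] by (simp add: power_divide power_mult_distrib power2_eq_square)
      finally show "\<sigma> $ i * (g $ i / (l2 * \<sigma> $ i - \<tau> $ i))\<^sup>2 \<le> (g $ i)\<^sup>2 / \<sigma> $ i / (l2 - m)\<^sup>2" .
    qed
    also have "\<dots> = G / (l2 - m)\<^sup>2"
      by (simp add: G_def sum_divide_distrib)
    also have "\<dots> \<le> \<gamma>\<^sup>2"
    proof -
      have "sqrt G \<le> \<gamma> * (l2 - m)" using gap(1) \<gamma> by (simp add: divide_le_eq mult.commute)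
      then have "(sqrt G)\<^sup>2 \<le> (\<gamma> * (l2 - m))\<^sup>2" using G by (intro power_mono) auto
      then show ?thesis using G gap(2) by (simp add: divide_le_eq power_mult_distrib)
    qed
    finally have hi: "\<phi> l2 \<le> \<gamma>\<^sup>2" .
    have "continuous_on {l1..l2} (\<lambda>l. \<sigma> $ i * (g $ i / (l * \<sigma> $ i - \<tau> $ i))\<^sup>2)" for i
    proof (cases "g $ i = 0")
      case False
      then show ?thesis using pos[of _ i] by (intro continuous_intros) force
    qed simp
    then have "continuous_on {l1..l2} \<phi>"
      unfolding \<phi>_def by (intro continuous_on_sum) auto
    then obtain l where l: "l1 \<le> l" "\<phi> l = \<gamma>\<^sup>2"
      using IVT2'[OF hi l1(2) l12] by blast
    define y where "y = (\<chi> i. g $ i / (l * \<sigma> $ i - \<tau> $ i))"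
    have "g $ i = (l * \<sigma> $ i - \<tau> $ i) * y $ i" for i
      using pos[OF l(1), of i] by (cases "g $ i = 0") (auto simp: y_def)
    moreover have "\<tau> $ i \<le> l * \<sigma> $ i" for i
      using m[of i] mult_right_mono[of m l "\<sigma> $ i"] l(1) l1(1) less_imp_le[OF \<sigma>[of i]] by linarith
    ultimately show ?thesis
      using that[of l y] m0 l l1(1) by (simp add: \<phi>_def y_def)
  qed
qed

text \<open>The set \<open>cone_Q\<close> is a rotated second-order cone, because
  \<open>(y + z)\<^sup>2 - (y - z)\<^sup>2 = 4 * y * z\<close>.\<close>

lemma cone_Q_iff: "(x, y, z) \<in> cone_Q \<longleftrightarrow> 0 \<le> y \<and> 0 \<le> z \<and> x\<^sup>2 \<le> y * z"
proof -
  have "(x, y, z) \<in> cone_Q \<longleftrightarrow> sqrt ((2 * x)\<^sup>2 + (y - z)\<^sup>2) \<le> y + z"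
    by (simp add: cone_Q_def norm_Pair)
  also have "\<dots> \<longleftrightarrow> 0 \<le> y + z \<and> (2 * x)\<^sup>2 + (y - z)\<^sup>2 \<le> (y + z)\<^sup>2"
  proof -
    have "0 \<le> sqrt ((2 * x)\<^sup>2 + (y - z)\<^sup>2)" by simp
    then show ?thesis
      using real_le_lsqrt[of "y + z" "(2 * x)\<^sup>2 + (y - z)\<^sup>2"] sqrt_le_D[of "(2 * x)\<^sup>2 + (y - z)\<^sup>2" "y + z"]
      by linarith
  qed
  also have "\<dots> \<longleftrightarrow> 0 \<le> y + z \<and> x\<^sup>2 \<le> y * z"
    by (simp add: power2_eq_square algebra_simps)
  also have "\<dots> \<longleftrightarrow> 0 \<le> y \<and> 0 \<le> z \<and> x\<^sup>2 \<le> y * z"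
  proof -
    have "0 \<le> y * z" if "x\<^sup>2 \<le> y * z"
      using that zero_le_power2[of x] by linarith
    then show ?thesis by (auto simp: zero_le_mult_iff)
  qed
  finally show ?thesis .
qed

text \<open>Young's inequality with the weight \<open>z\<close>: the arithmetic mean of \<open>t\<close> and \<open>z * y\<^sup>2\<close> dominates
  their geometric mean, which dominates the absolute value of \<open>x * y\<close>. In this form it also covers
  \<open>z = 0\<close>, where the cone forces \<open>x = 0\<close>.\<close>

lemma cone_Q_young:
  assumes "(x, t, z) \<in> cone_Q"
  shows "2 * x * y \<le> t + z * y\<^sup>2"
proof (rule power2_le_imp_le)
  have c: "0 \<le> t" "0 \<le> z" "x\<^sup>2 \<le> t * z" using assms by (auto simp: cone_Q_iff)
  have "x\<^sup>2 * y\<^sup>2 \<le> t * z * y\<^sup>2" using c(3) by (intro mult_right_mono) auto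
  moreover have "4 * (t * z * y\<^sup>2) \<le> (t + z * y\<^sup>2)\<^sup>2"
    using zero_le_power2[of "t - z * y\<^sup>2"] by (simp add: power2_eq_square algebra_simps)
  ultimately show "(2 * x * y)\<^sup>2 \<le> (t + z * y\<^sup>2)\<^sup>2"
    by (simp add: power_mult_distrib)
  show "0 \<le> t + z * y\<^sup>2" using c by simp
qed

lemma trust_region_weak_duality:
  fixes \<sigma> \<tau> g y t :: "real ^ 'm::finite"
  assumes l: "0 \<le> l" and cone: "\<And>i. (g $ i, t $ i, l * \<sigma> $ i - \<tau> $ i) \<in> cone_Q"
    and y: "(\<Sum>i\<in>UNIV. \<sigma> $ i * (y $ i)\<^sup>2) \<le> \<gamma>\<^sup>2"
  shows "(\<Sum>i\<in>UNIV. \<tau> $ i * (y $ i)\<^sup>2 + 2 * (g $ i * y $ i)) \<le> 1 \<bullet> t + \<gamma>\<^sup>2 * l"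
proof -
  have "(\<Sum>i\<in>UNIV. \<tau> $ i * (y $ i)\<^sup>2 + 2 * (g $ i * y $ i))
      \<le> (\<Sum>i\<in>UNIV. t $ i + l * (\<sigma> $ i * (y $ i)\<^sup>2))"
  proof (intro sum_mono)
    show "\<tau> $ i * (y $ i)\<^sup>2 + 2 * (g $ i * y $ i) \<le> t $ i + l * (\<sigma> $ i * (y $ i)\<^sup>2)" for i
      using cone_Q_young[OF cone[of i], of "y $ i"] by (simp add: algebra_simps)
  qed
  also have "\<dots> = 1 \<bullet> t + l * (\<Sum>i\<in>UNIV. \<sigma> $ i * (y $ i)\<^sup>2)"
    by (simp add: inner_vec_def sum.distrib sum_distrib_left)
  also have "\<dots> \<le> 1 \<bullet> t + \<gamma>\<^sup>2 * l"
    using mult_left_mono[OF y l] by (simp add: mult.commute)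
  finally show ?thesis .
qed

text \<open>At the stationary point \<open>y\<close> Young's inequality is an equality in every coordinate when
  \<open>t i = (l * \<sigma> i - \<tau> i) * (y i)\<^sup>2\<close>. This \<open>t\<close> replaces the quotient of \<open>(g i)\<^sup>2\<close> by
  \<open>l * \<sigma> i - \<tau> i\<close> and makes sense at a zero denominator as well.\<close>

lemma trust_region_strong_duality:
  fixes \<sigma> \<tau> g :: "real ^ 'm::finite"
  assumes "\<And>i. 0 < \<sigma> $ i" "\<And>i. 0 \<le> \<tau> $ i" "0 < \<gamma>"
  obtains l t y where "0 \<le> l" "\<And>i. (g $ i, t $ i, l * \<sigma> $ i - \<tau> $ i) \<in> cone_Q"
    "(\<Sum>i\<in>UNIV. \<sigma> $ i * (y $ i)\<^sup>2) = \<gamma>\<^sup>2"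
    "(\<Sum>i\<in>UNIV. \<tau> $ i * (y $ i)\<^sup>2 + 2 * (g $ i * y $ i)) = 1 \<bullet> t + \<gamma>\<^sup>2 * l"
proof -
  obtain l y where l: "0 \<le> l" "\<And>i. \<tau> $ i \<le> l * \<sigma> $ i"
    and g: "\<And>i. g $ i = (l * \<sigma> $ i - \<tau> $ i) * y $ i"
    and len: "(\<Sum>i\<in>UNIV. \<sigma> $ i * (y $ i)\<^sup>2) = \<gamma>\<^sup>2"
    by (rule trust_region_multiplier[OF assms, of g]) (rule that; blast)
  define t where "t = (\<chi> i. (l * \<sigma> $ i - \<tau> $ i) * (y $ i)\<^sup>2)"
  have "(g $ i, t $ i, l * \<sigma> $ i - \<tau> $ i) \<in> cone_Q" for i
    using l(2)[of i] by (simp add: cone_Q_iff t_def g power2_eq_square)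
  moreover have "(\<Sum>i\<in>UNIV. \<tau> $ i * (y $ i)\<^sup>2 + 2 * (g $ i * y $ i))
      = (\<Sum>i\<in>UNIV. t $ i + l * (\<sigma> $ i * (y $ i)\<^sup>2))"
    by (intro sum.cong) (simp_all add: t_def g power2_eq_square algebra_simps)
  then have "(\<Sum>i\<in>UNIV. \<tau> $ i * (y $ i)\<^sup>2 + 2 * (g $ i * y $ i)) = 1 \<bullet> t + \<gamma>\<^sup>2 * l"
    by (simp add: inner_vec_def sum.distrib sum_distrib_left[symmetric] len mult.commute)
  ultimately show thesis using that l(1) len by blast
qed

section \<open>The regret of a quadratic cost\<close>

text \<open>The term \<open>f\<close> collects everything in the cost that depends on the disturbance only. It is the
  same for \<open>u\<close> and for the best input in hindsight, so it drops out of the regret.\<close>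

lemma regret_quadratic:
  assumes M: "sym_pd M"
    and J: "\<And>u w. J u w = f w + u \<bullet> (M *v u) + 2 * ((b + D *v w) \<bullet> u)"
  shows "regret J u w = ereal (u \<bullet> (M *v u) + 2 * (b \<bullet> u) + b \<bullet> (matrix_inv M *v b)
    + w \<bullet> ((transpose D ** matrix_inv M ** D) *v w)
    + 2 * ((transpose D *v (matrix_inv M *v b + u)) \<bullet> w))"
proof -
  define P where "P = matrix_inv M"
  define h where "h = b + D *v w"
  have Jsq: "J v w = f w - h \<bullet> (P *v h) + (v + P *v h) \<bullet> (M *v (v + P *v h))" for v
    using complete_square[OF M, of v h] by (simp add: J h_def[symmetric] P_def)
  have "(INF v. ereal (J v w)) = ereal (f w - h \<bullet> (P *v h))"
  proof (rule INF_eqI)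
    show "ereal (f w - h \<bullet> (P *v h)) \<le> ereal (J v w)" for v
      using sym_pd_nonneg[OF M, of "v + P *v h"] by (simp add: Jsq)
    show "z \<le> ereal (f w - h \<bullet> (P *v h))" if "\<And>v. v \<in> UNIV \<Longrightarrow> z \<le> ereal (J v w)" for z
      using that[of "- (P *v h)"] by (simp add: Jsq)
  qed
  then have "regret J u w = ereal (u \<bullet> (M *v u) + 2 * (h \<bullet> u) + h \<bullet> (P *v h))"
    by (simp add: regret_def J h_def)
  also have "h \<bullet> (P *v h) = b \<bullet> (P *v b) + 2 * ((transpose D *v (P *v b)) \<bullet> w)
      + w \<bullet> ((transpose D ** P ** D) *v w)"
    using matrix_inv_sym[OF M, of b "D *v w"] inner_transpose_mult[of D "P *v b" w]
      inner_transpose_mult[of D "P *v (D *v w)" w]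
    by (simp add: h_def P_def matrix_vector_right_distrib inner_add_left inner_add_right
        matrix_vector_mul_assoc[symmetric] inner_commute del: transpose_matrix_vector)
  also have "h \<bullet> u = b \<bullet> u + (transpose D *v u) \<bullet> w"
    using inner_transpose_mult[of D u w]
    by (simp add: h_def inner_add_left inner_commute[of u] del: transpose_matrix_vector)
  finally show ?thesis
    by (simp add: P_def matrix_vector_right_distrib inner_add_left algebra_simps
        del: transpose_matrix_vector)
qed

lemma diag_quadratic: "y \<bullet> (diag d *v y) = (\<Sum>i\<in>UNIV. d $ i * (y $ i)\<^sup>2)"
proof -
  have "(diag d *v y) $ i = d $ i * y $ i" for i
    by (simp add: diag_def matrix_vector_mult_def if_distrib[of "\<lambda>x. x * _"] cong: if_cong)
  then show ?thesis
    by (simp add: inner_vec_def power2_eq_square algebra_simps)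
qed

lemma congruent_diag_quadratic:
  assumes "transpose S ** K ** S = diag d"
  shows "(S *v y) \<bullet> (K *v (S *v y)) = (\<Sum>i\<in>UNIV. d $ i * (y $ i)\<^sup>2)"
  using inner_transpose_mult[of S "K *v (S *v y)" y]
  by (simp add: diag_quadratic[symmetric] assms[symmetric] matrix_vector_mul_assoc[symmetric]
      inner_commute del: transpose_matrix_vector)

lemma diag_entry:
  "(\<Sum>i\<in>UNIV. d $ i * (axis k 1 $ i)\<^sup>2) = (d $ k :: real)"
proof -
  have "(\<Sum>i\<in>UNIV. d $ i * (axis k 1 $ i)\<^sup>2) = (\<Sum>i\<in>UNIV. if i = k then d $ k else 0)"
    by (intro sum.cong) (auto simp: axis_def)
  then show ?thesis by simp
qed

text \<open>A feasible \<open>(l, t)\<close> certifies an upper bound on the worst-case regret by weak duality, and a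
  pair with equality exists by strong duality. Invertibility of \<open>S\<close> makes \<open>w = S y\<close> range over all
  disturbances and makes every \<open>\<sigma> i\<close> positive.\<close>

lemma worst_regret_dual:
  fixes M :: "real ^ 'p ^ 'p::finite" and D :: "real ^ 'm::finite ^ 'p" and S :: "real ^ 'm ^ 'm"
    and J :: "real ^ 'p \<Rightarrow> real ^ 'm \<Rightarrow> real"
  assumes M: "sym_pd M"
    and J: "\<And>u w. J u w = f w + u \<bullet> (M *v u) + 2 * ((b + D *v w) \<bullet> u)"
    and \<gamma>: "0 < \<gamma>" and S: "invertible S" and \<sigma>: "transpose S ** S = diag \<sigma>"
    and \<tau>: "transpose S ** transpose D ** matrix_inv M ** D ** S = diag \<tau>"
  defines "c \<equiv> b \<bullet> (matrix_inv M *v b)"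
  shows "(u, l, t) \<in> reform_feasible U S M b D \<sigma> \<tau> \<Longrightarrow>
      worst_regret J \<gamma> u \<le> ereal (reform_objective M b \<gamma> (u, l, t) + c)"
    and "u \<in> U \<Longrightarrow> \<exists>l t. (u, l, t) \<in> reform_feasible U S M b D \<sigma> \<tau> \<and>
      worst_regret J \<gamma> u = ereal (reform_objective M b \<gamma> (u, l, t) + c)"
proof -
  define g where "g = transpose S *v (transpose D *v (matrix_inv M *v b + u))"
  have norm_S: "(norm (S *v y))\<^sup>2 = (\<Sum>i\<in>UNIV. \<sigma> $ i * (y $ i)\<^sup>2)" for y
    using congruent_diag_quadratic[of S "mat 1" \<sigma> y] \<sigma> by (simp add: power2_norm_eq_inner)
  have \<tau>': "transpose S ** (transpose D ** matrix_inv M ** D) ** S = diag \<tau>"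
    using \<tau> by (simp add: matrix_mul_assoc)
  have quad: "(S *v y) \<bullet> ((transpose D ** matrix_inv M ** D) *v (S *v y))
      = (\<Sum>i\<in>UNIV. \<tau> $ i * (y $ i)\<^sup>2)" for y
    by (rule congruent_diag_quadratic[OF \<tau>'])
  have lin: "(transpose D *v (matrix_inv M *v b + u)) \<bullet> (S *v y) = (\<Sum>i\<in>UNIV. g $ i * y $ i)" for y
    using inner_transpose_mult[of S "transpose D *v (matrix_inv M *v b + u)" y]
    by (simp add: g_def[symmetric] inner_vec_def[of g] del: transpose_matrix_vector)
  have regret: "regret J u (S *v y) = ereal (u \<bullet> (M *v u) + 2 * (b \<bullet> u) + c
      + (\<Sum>i\<in>UNIV. \<tau> $ i * (y $ i)\<^sup>2 + 2 * (g $ i * y $ i)))" for y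
    unfolding regret_quadratic[OF M J] quad lin c_def
    by (simp add: sum.distrib sum_distrib_left)
  have weak: "worst_regret J \<gamma> u \<le> ereal (reform_objective M b \<gamma> (u, l, t) + c)"
    if "(u, l, t) \<in> reform_feasible U S M b D \<sigma> \<tau>" for l t
    unfolding worst_regret_def
  proof (rule SUP_least)
    fix w :: "real ^ 'm" assume "w \<in> {w. norm w \<le> \<gamma>}"
    define y where "y = matrix_inv S *v w"
    have w: "w = S *v y" by (simp add: y_def matrix_inv_cancel[OF S])
    have "(norm w)\<^sup>2 \<le> \<gamma>\<^sup>2" using \<open>w \<in> _\<close> by (intro power_mono) auto
    then have "(\<Sum>i\<in>UNIV. \<tau> $ i * (y $ i)\<^sup>2 + 2 * (g $ i * y $ i)) \<le> 1 \<bullet> t + \<gamma>\<^sup>2 * l"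
      using that by (intro trust_region_weak_duality[where \<sigma> = \<sigma>])
        (auto simp: reform_feasible_def g_def w norm_S simp del: transpose_matrix_vector)
    then show "regret J u w \<le> ereal (reform_objective M b \<gamma> (u, l, t) + c)"
      by (simp add: w regret reform_objective_def)
  qed
  show "(u, l, t) \<in> reform_feasible U S M b D \<sigma> \<tau> \<Longrightarrow>
      worst_regret J \<gamma> u \<le> ereal (reform_objective M b \<gamma> (u, l, t) + c)"
    by (rule weak)
  assume u: "u \<in> U"
  \<comment> \<open>The diagonal entries are the values of the two quadratic forms at the columns of \<open>S\<close>.\<close>
  have \<sigma>_pos: "0 < \<sigma> $ k" for k
  proof -
    have "axis k 1 = matrix_inv S *v (S *v axis k (1 :: real))"
      by (simp add: matrix_vector_mul_assoc matrix_inv_left[OF S])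
    then have "S *v axis k 1 \<noteq> 0"
      by (metis axis_eq_0_iff matrix_vector_mult_0_right zero_neq_one)
    then show ?thesis using norm_S[of "axis k 1"] unfolding diag_entry
      by (metis norm_eq_zero zero_less_power2)
  qed
  have \<tau>_nonneg: "0 \<le> \<tau> $ k" for k
  proof -
    have "0 \<le> (D *v (S *v axis k 1)) \<bullet> (matrix_inv M *v (D *v (S *v axis k 1)))"
      by (rule matrix_inv_psd[OF M])
    also have "\<dots> = (S *v axis k 1) \<bullet> ((transpose D ** matrix_inv M ** D) *v (S *v axis k 1))"
      using inner_transpose_mult[of D "matrix_inv M *v (D *v (S *v axis k 1))" "S *v axis k 1"]
      by (simp add: matrix_vector_mul_assoc[symmetric] inner_commute del: transpose_matrix_vector)
    also have "\<dots> = \<tau> $ k"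
      by (simp only: quad diag_entry)
    finally show ?thesis .
  qed
  obtain l t y where lt: "0 \<le> l" "\<And>i. (g $ i, t $ i, l * \<sigma> $ i - \<tau> $ i) \<in> cone_Q"
    and y: "(\<Sum>i\<in>UNIV. \<sigma> $ i * (y $ i)\<^sup>2) = \<gamma>\<^sup>2"
    and eq: "(\<Sum>i\<in>UNIV. \<tau> $ i * (y $ i)\<^sup>2 + 2 * (g $ i * y $ i)) = 1 \<bullet> t + \<gamma>\<^sup>2 * l"
    by (rule trust_region_strong_duality[OF \<sigma>_pos \<tau>_nonneg \<gamma>, of g]) (rule that; blast)
  have feas: "(u, l, t) \<in> reform_feasible U S M b D \<sigma> \<tau>"
    using u lt by (simp add: reform_feasible_def g_def del: transpose_matrix_vector)
  have "norm (S *v y) \<le> \<gamma>"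
    by (rule power2_le_imp_le) (use \<gamma> in \<open>simp_all add: norm_S y\<close>)
  then have "regret J u (S *v y) \<le> worst_regret J \<gamma> u"
    unfolding worst_regret_def by (intro SUP_upper) auto
  also have "regret J u (S *v y) = ereal (reform_objective M b \<gamma> (u, l, t) + c)"
    by (simp add: regret eq reform_objective_def)
  finally have "worst_regret J \<gamma> u = ereal (reform_objective M b \<gamma> (u, l, t) + c)"
    by (rule antisym[OF weak[OF feas]])
  with feas show "\<exists>l t. (u, l, t) \<in> reform_feasible U S M b D \<sigma> \<tau> \<and>
      worst_regret J \<gamma> u = ereal (reform_objective M b \<gamma> (u, l, t) + c)"
    by blast
qed

section \<open>Equivalence of the two problems\<close>

text \<open>Since \<open>f u\<close> is the least value of \<open>h + c\<close> over the fibre of \<open>F\<close> above \<open>u\<close>, minimising \<open>h\<close>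
  over \<open>F\<close> is minimising \<open>f\<close> over \<open>U\<close>. Attainment in each fibre is what lifts a minimiser of \<open>f\<close> to
  one of \<open>h\<close>.\<close>

lemma partial_minimisation:
  fixes f :: "'a \<Rightarrow> ereal" and h :: "'a \<times> 'b \<times> 'c \<Rightarrow> real"
  assumes le: "\<And>u l t. (u, l, t) \<in> F \<Longrightarrow> u \<in> U \<and> f u \<le> ereal (h (u, l, t) + c)"
    and ex: "\<And>u. u \<in> U \<Longrightarrow> \<exists>l t. (u, l, t) \<in> F \<and> f u = ereal (h (u, l, t) + c)"
  shows "(INF u\<in>U. f u) = (INF z\<in>F. ereal (h z)) + ereal c"
    and "is_arg_min f (\<lambda>u. u \<in> U) u \<longleftrightarrow> (\<exists>l t. is_arg_min h (\<lambda>z. z \<in> F) (u, l, t))"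
proof -
  have "(INF u\<in>U. f u) = (INF z\<in>F. ereal (h z + c))"
  proof (rule antisym)
    show "(INF u\<in>U. f u) \<le> (INF z\<in>F. ereal (h z + c))"
    proof (rule INF_mono)
      fix z assume "z \<in> F"
      moreover obtain u l t where "z = (u, l, t)" by (rule prod_cases3)
      ultimately show "\<exists>u\<in>U. f u \<le> ereal (h z + c)" using le[of u l t] by blast
    qed
    show "(INF z\<in>F. ereal (h z + c)) \<le> (INF u\<in>U. f u)"
    proof (rule INF_mono)
      fix u assume "u \<in> U"
      then obtain l t where "(u, l, t) \<in> F" "f u = ereal (h (u, l, t) + c)"
        using ex[of u] by blast
      then show "\<exists>z\<in>F. ereal (h z + c) \<le> f u" by (intro bexI[of _ "(u, l, t)"]) simp_all
    qed
  qed
  also have "\<dots> = (INF z\<in>F. ereal (h z)) + ereal c"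
  proof (rule antisym)
    have "(INF z\<in>F. ereal (h z + c)) - ereal c \<le> (INF z\<in>F. ereal (h z))"
    proof (rule INF_greatest)
      fix z assume "z \<in> F"
      then have "(INF z\<in>F. ereal (h z + c)) \<le> ereal (h z) + ereal c"
        by (auto intro: INF_lower2)
      then show "(INF z\<in>F. ereal (h z + c)) - ereal c \<le> ereal (h z)"
        by (simp add: ereal_minus_le)
    qed
    then show "(INF z\<in>F. ereal (h z + c)) \<le> (INF z\<in>F. ereal (h z)) + ereal c"
      by (simp add: ereal_minus_le)
    show "(INF z\<in>F. ereal (h z)) + ereal c \<le> (INF z\<in>F. ereal (h z + c))"
      by (auto intro!: INF_greatest add_right_mono INF_lower simp flip: plus_ereal.simps(1))
  qed
  finally show "(INF u\<in>U. f u) = (INF z\<in>F. ereal (h z)) + ereal c" .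
  show "is_arg_min f (\<lambda>u. u \<in> U) u \<longleftrightarrow> (\<exists>l t. is_arg_min h (\<lambda>z. z \<in> F) (u, l, t))"
  proof
    assume u: "is_arg_min f (\<lambda>u. u \<in> U) u"
    then obtain l t where lt: "(u, l, t) \<in> F" "f u = ereal (h (u, l, t) + c)"
      using ex[of u] by (auto simp: is_arg_min_def)
    have "h (u, l, t) \<le> h (u', l', t')" if "(u', l', t') \<in> F" for u' l' t'
    proof -
      have "f u \<le> f u'" using u le[OF that] by (auto simp: is_arg_min_def not_less)
      then have "ereal (h (u, l, t) + c) \<le> ereal (h (u', l', t') + c)"
        using lt(2) le[OF that] by (metis order_trans)
      then show ?thesis by simp
    qed
    then have "is_arg_min h (\<lambda>z. z \<in> F) (u, l, t)"
      using lt(1) by (auto simp: is_arg_min_def not_less)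
    then show "\<exists>l t. is_arg_min h (\<lambda>z. z \<in> F) (u, l, t)" by blast
  next
    assume "\<exists>l t. is_arg_min h (\<lambda>z. z \<in> F) (u, l, t)"
    then obtain l t where lt: "(u, l, t) \<in> F" "\<And>z. z \<in> F \<Longrightarrow> h (u, l, t) \<le> h z"
      by (auto simp: is_arg_min_def not_less)
    have "f u \<le> f u'" if u': "u' \<in> U" for u'
    proof -
      obtain l' t' where *: "(u', l', t') \<in> F" "f u' = ereal (h (u', l', t') + c)"
        using ex[OF u'] by blast
      have "f u \<le> ereal (h (u, l, t) + c)" using le[OF lt(1)] by blast
      also have "\<dots> \<le> f u'" using lt(2)[OF *(1)] *(2) by simp
      finally show ?thesis .
    qed
    then show "is_arg_min f (\<lambda>u. u \<in> U) u"
      using le[OF lt(1)] by (auto simp: is_arg_min_def not_less)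
  qed
qed

theorem mainTheorem2:
  fixes A :: "nat \<Rightarrow> real ^ 'nx ^ 'nx::finite"
    and B :: "nat \<Rightarrow> real ^ 'nu::finite ^ 'nx"
    and C :: "nat \<Rightarrow> real ^ 'nw::finite ^ 'nx"
    and Q :: "nat \<Rightarrow> real ^ 'nx ^ 'nx"
    and q :: "nat \<Rightarrow> real ^ 'nx"
    and R :: "nat \<Rightarrow> real ^ 'nu ^ 'nu"
    and r :: "nat \<Rightarrow> real ^ 'nu"
    and x0 :: "real ^ 'nx"
    and \<gamma> :: real
    and U :: "(real ^ ('t::{finite,linorder} \<times> 'nu)) set"
    and J :: "real ^ ('t \<times> 'nu) \<Rightarrow> real ^ ('t \<times> 'nw) \<Rightarrow> real"
    and BB :: "real ^ ('t \<times> 'nu) ^ ('t \<times> 'nu)"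
    and b :: "real ^ ('t \<times> 'nu)"
    and D :: "real ^ ('t \<times> 'nw) ^ ('t \<times> 'nu)"
    and S :: "real ^ ('t \<times> 'nw) ^ ('t \<times> 'nw)"
    and \<sigma> \<tau> :: "real ^ ('t \<times> 'nw)"
  assumes "\<And>k. 1 \<le> k \<Longrightarrow> k \<le> CARD('t) \<Longrightarrow> sym_psd (Q k)"
    and "\<And>k. k < CARD('t) \<Longrightarrow> sym_pd (R k)"
    and "J = cost A B C Q q R r x0"
    and "BB = compact_B A B Q R"
    and "b = compact_b A B Q q r x0"
    and "D = compact_D A B C Q"
    and "\<gamma> > 0"
    and "closed U" and "convex U"
    and "invertible S"
    and "transpose S ** S = diag \<sigma>"
    and "transpose S ** transpose D ** matrix_inv BB ** D ** S = diag \<tau>"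
  shows "(INF u\<in>U. worst_regret J \<gamma> u) =
           (INF z\<in>reform_feasible U S BB b D \<sigma> \<tau>. ereal (reform_objective BB b \<gamma> z))
           + ereal (b \<bullet> (matrix_inv BB *v b))
       \<and> (\<forall>u. is_arg_min (worst_regret J \<gamma>) (\<lambda>u. u \<in> U) u \<longleftrightarrow>
            (\<exists>l t. is_arg_min (reform_objective BB b \<gamma>)
                     (\<lambda>z. z \<in> reform_feasible U S BB b D \<sigma> \<tau>) (u, l, t)))"
proof -
  have M: "sym_pd BB"
    unfolding \<open>BB = _\<close> using assms(1,2) by (rule compact_B_sym_pd)
  obtain f where f: "J u w = f w + u \<bullet> (BB *v u) + 2 * ((b + D *v w) \<bullet> u)" for u w
  proof -
    define Ac :: "real ^ 'nx ^ ('t \<times> 'nx)" where "Ac = state_mat A"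
    define Cc :: "real ^ ('t \<times> 'nw) ^ ('t \<times> 'nx)" where "Cc = input_mat A C"
    define Qb :: "real ^ ('t \<times> 'nx) ^ ('t \<times> 'nx)" where "Qb = Qbar Q"
    define qb :: "real ^ ('t \<times> 'nx)" where "qb = qbar q"
    show thesis
    proof (rule that[of "\<lambda>w. w \<bullet> ((transpose Cc ** Qb ** Cc) *v w)
        + 2 * ((transpose Cc *v (qb + Qb *v (Ac *v x0))) \<bullet> w)
        + 2 * ((transpose Ac *v qb) \<bullet> x0) + x0 \<bullet> ((transpose Ac ** Qb ** Ac) *v x0)"], goal_cases)
      case (1 u w)
      show ?case
        using cost_compact[where A = A and B = B and C = C and Q = Q and q = q and R = R and r = r
            and ?x0.0 = x0 and u = u and w = w, OF assms(1)] inner_transpose_mult[of D u w]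
        unfolding Ac_def[symmetric] Cc_def[symmetric] Qb_def[symmetric] qb_def[symmetric]
          \<open>J = _\<close>[symmetric] \<open>BB = _\<close>[symmetric] \<open>b = _\<close>[symmetric] \<open>D = _\<close>[symmetric]
        by (simp add: inner_add_left inner_commute[of u "D *v w"] algebra_simps
            del: transpose_matrix_vector)
    qed
  qed
  note dual = worst_regret_dual[OF M f \<open>\<gamma> > 0\<close> \<open>invertible S\<close>
      \<open>transpose S ** S = diag \<sigma>\<close> assms(12)]
  have "u \<in> U \<and> worst_regret J \<gamma> u
      \<le> ereal (reform_objective BB b \<gamma> (u, l, t) + b \<bullet> (matrix_inv BB *v b))"
    if "(u, l, t) \<in> reform_feasible U S BB b D \<sigma> \<tau>" for u l t
    using dual(1)[OF that] that by (simp add: reform_feasible_def)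
  note eqs = partial_minimisation[OF this dual(2)]
  show ?thesis
    by (intro conjI allI eqs)
qed

end
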